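(* Let $p$ be an odd prime and $n\ge p$. Identify the vertices of the $n$-cube with the subsets of the $n$-element set $\{x_1,\ldots,x_{n-p},y_1,\ldots,y_p\}$, and let $\mathbb Z_p$ act on $\operatorname{Cube}(n,n-2)$ by cyclically permuting $y_1,\ldots,y_p$ and fixing each $x_i$. Let $\mathcal H=\operatorname{Cube}(n,n-2)/\mathbb Z_p$. Then $\Theta(\mathcal H)$ is contractible.
   Context: A hypergraph $\mathcal H=(V,H)$ is a nonempty set $V$ of vertices with a collection $H$ of subsets of $V$, called hyperedges. $\Theta(\mathcal H)$ is the simplicial complex whose simplices are the (nonempty) finite subsets of complements $V\setminus h$ of hyperedges $h\in H$. $\operatorname{Cube}(n,k)$ is the hypergraph whose vertices are the vertices of the $n$-cube and whose hyperedges are the sets of vertices spanning $k$-dimensional faces of the $n$-cube; with vertices identified with subsets of an $n$-element set $S$, a $k$-dimensional face is a set of the form $\{A\cup B: B\subseteq T\}$ with $T\subseteq S$, $|T|=k$, and $A\subseteq S\setminus T$ fixed. If a group $G$ acts on the vertices of $\mathcal H$ carrying hyperedges to hyperedges, the quotient hypergraph $\mathcal H/G$ has vertex set $V/G$ and its hyperedges are the images of the hyperedges of $\mathcal H$ under $V\to V/G$. *)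

theory Defs
  imports
    "HOL-Analysis.Analysis"
    "HOL-Algebra.Elementary_Groups"
    "HOL-Algebra.Group_Action"
    "HOL-Computational_Algebra.Primes"
begin

section \<open>Hypergraphs and their quotients\<close>

record 'a hypergraph =
  verts :: "'a set"
  hyperedges :: "'a set set"

definition wf_hypergraph :: "'a hypergraph \<Rightarrow> bool" where
  "wf_hypergraph H \<longleftrightarrow> verts H \<noteq> {} \<and> hyperedges H \<subseteq> Pow (verts H)"

definition hypergraph_action ::
    "('g, 'm) monoid_scheme \<Rightarrow> ('g \<Rightarrow> 'a \<Rightarrow> 'a) \<Rightarrow> 'a hypergraph \<Rightarrow> bool" where
  "hypergraph_action G \<phi> H \<longleftrightarrow>
     group_action G (verts H) \<phi> \<and>
     (\<forall>g\<in>carrier G. \<forall>h\<in>hyperedges H. \<phi> g ` h \<in> hyperedges H)"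

definition quotient_hypergraph ::
    "('g, 'm) monoid_scheme \<Rightarrow> ('g \<Rightarrow> 'a \<Rightarrow> 'a) \<Rightarrow> 'a hypergraph \<Rightarrow> 'a set hypergraph" where
  "quotient_hypergraph G \<phi> H =
     \<lparr>verts = orbits G (verts H) \<phi>, hyperedges = (\<lambda>h. orbit G \<phi> ` h) ` hyperedges H\<rparr>"

lemma wf_quotient_hypergraph:
  "wf_hypergraph H \<Longrightarrow> wf_hypergraph (quotient_hypergraph G \<phi> H)"
  unfolding wf_hypergraph_def quotient_hypergraph_def orbits_def by auto


section \<open>The simplicial complex of a hypergraph and its geometric realization\<close>

definition Theta :: "'a hypergraph \<Rightarrow> 'a set set" where
  "Theta H = {\<sigma>. finite \<sigma> \<and> \<sigma> \<noteq> {} \<and> (\<exists>h\<in>hyperedges H. \<sigma> \<subseteq> verts H - h)}"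

lemma Theta_face: "\<sigma> \<in> Theta H \<Longrightarrow> \<tau> \<subseteq> \<sigma> \<Longrightarrow> \<tau> \<noteq> {} \<Longrightarrow> \<tau> \<in> Theta H"
  by (auto simp: Theta_def intro: finite_subset)

text \<open>Points of the realization are given by their barycentric coordinates.\<close>

definition closed_simplex :: "'a set \<Rightarrow> ('a \<Rightarrow> real) set" where
  "closed_simplex \<sigma> = {t. (\<forall>v. 0 \<le> t v) \<and> (\<forall>v. v \<notin> \<sigma> \<longrightarrow> t v = 0) \<and> (\<Sum>v\<in>\<sigma>. t v) = 1}"

text \<open>
  The realization carries the weak (coherent) topology: a set is open iff it meets every closed
  simplex in a relatively open set. On a single closed simplex the product topology of the
  function space is the Euclidean one, since all but finitely many coordinates vanish there.
\<close>

definition realization :: "'a set set \<Rightarrow> ('a \<Rightarrow> real) topology" where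
  "realization K = topology (\<lambda>U. U \<subseteq> (\<Union>\<sigma>\<in>K. closed_simplex \<sigma>) \<and>
     (\<forall>\<sigma>\<in>K. openin (top_of_set (closed_simplex \<sigma>)) (U \<inter> closed_simplex \<sigma>)))"

lemma openin_realization:
  "openin (realization K) U \<longleftrightarrow> U \<subseteq> (\<Union>\<sigma>\<in>K. closed_simplex \<sigma>) \<and>
     (\<forall>\<sigma>\<in>K. openin (top_of_set (closed_simplex \<sigma>)) (U \<inter> closed_simplex \<sigma>))"
proof -
  have "istopology (\<lambda>U. U \<subseteq> (\<Union>\<sigma>\<in>K. closed_simplex \<sigma>) \<and>
     (\<forall>\<sigma>\<in>K. openin (top_of_set (closed_simplex \<sigma>)) (U \<inter> closed_simplex \<sigma>)))" (is "istopology ?L")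
    unfolding istopology_def
  proof (intro conjI allI impI)
    fix S T assume "?L S" "?L T"
    then show "S \<inter> T \<subseteq> (\<Union>\<sigma>\<in>K. closed_simplex \<sigma>)" by blast
    have "S \<inter> T \<inter> C = (S \<inter> C) \<inter> (T \<inter> C)" for C by blast
    with \<open>?L S\<close> \<open>?L T\<close>
    show "\<forall>\<sigma>\<in>K. openin (top_of_set (closed_simplex \<sigma>)) (S \<inter> T \<inter> closed_simplex \<sigma>)"
      by (simp add: openin_Int)
  next
    fix \<U> assume U: "\<forall>S\<in>\<U>. ?L S"
    then show "\<Union>\<U> \<subseteq> (\<Union>\<sigma>\<in>K. closed_simplex \<sigma>)" by blast
    have "\<Union>\<U> \<inter> C = (\<Union>S\<in>\<U>. S \<inter> C)" for C by blast
    with U show "\<forall>\<sigma>\<in>K. openin (top_of_set (closed_simplex \<sigma>)) (\<Union>\<U> \<inter> closed_simplex \<sigma>)"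
      by (simp only:) (blast intro: openin_Union)
  qed
  then show ?thesis
    by (simp add: realization_def topology_inverse')
qed

lemma topspace_realization: "topspace (realization K) = (\<Union>\<sigma>\<in>K. closed_simplex \<sigma>)"
proof
  show "topspace (realization K) \<subseteq> (\<Union>\<sigma>\<in>K. closed_simplex \<sigma>)"
    using openin_realization[of K "topspace (realization K)"] by simp
  have "(\<Union>\<sigma>\<in>K. closed_simplex \<sigma>) \<inter> closed_simplex \<tau> = closed_simplex \<tau>" if "\<tau> \<in> K" for \<tau>
    using that by blast
  then have "openin (realization K) (\<Union>\<sigma>\<in>K. closed_simplex \<sigma>)"
    unfolding openin_realization by simp
  then show "(\<Union>\<sigma>\<in>K. closed_simplex \<sigma>) \<subseteq> topspace (realization K)"
    by (rule openin_subset)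
qed


section \<open>Cubes and the cyclic action\<close>

text \<open>The vertices of the cube on \<open>S\<close> are the subsets of \<open>S\<close>.\<close>

definition cube :: "'s set \<Rightarrow> nat \<Rightarrow> 's set hypergraph" where
  "cube S k =
     \<lparr>verts = Pow S,
      hyperedges = {{A \<union> B | B. B \<subseteq> T} | A T. T \<subseteq> S \<and> card T = k \<and> A \<subseteq> S - T}\<rparr>"

lemma wf_cube: "wf_hypergraph (cube S k)"
  by (auto simp: wf_hypergraph_def cube_def)

datatype label = X nat | Y nat

definition labels :: "nat \<Rightarrow> nat \<Rightarrow> label set" where
  "labels n p = X ` {1..n - p} \<union> Y ` {1..p}"

lemma finite_labels: "finite (labels n p)"
  by (simp add: labels_def)

lemma card_labels:
  assumes "p \<le> n"
  shows "card (labels n p) = n"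
proof -
  have "card (labels n p) = card (X ` {1..n - p}) + card (Y ` {1..p})"
    unfolding labels_def by (rule card_Un_disjoint) auto
  then show ?thesis
    using assms by (simp add: card_image inj_on_def)
qed

fun cycle_Y :: "nat \<Rightarrow> label \<Rightarrow> label" where
  "cycle_Y p (X i) = X i"
| "cycle_Y p (Y j) = Y (if j = p then 1 else j + 1)"

text \<open>
  \<open>k \<in> {0..<p}\<close>, an element of \<open>integer_mod_group p\<close>, acts by the \<open>k\<close>-th power of the generator;
  \<open>BijGroup\<close>, and hence \<open>group_action\<close>, requires functions that are extensional on the vertex set.
\<close>

definition cyclic_action :: "nat \<Rightarrow> nat \<Rightarrow> int \<Rightarrow> label set \<Rightarrow> label set" where
  "cyclic_action n p k = (\<lambda>A\<in>Pow (labels n p). (cycle_Y p ^^ nat k) ` A)"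

lemma funpow_cycle_X: "(cycle_Y p ^^ k) (X i) = X i"
  by (induction k) auto

lemma funpow_cycle_Y:
  assumes "j \<in> {1..p}"
  shows "(cycle_Y p ^^ k) (Y j) = Y ((j - 1 + k) mod p + 1)"
proof (induction k)
  case 0
  then show ?case using assms by auto
next
  case (Suc k)
  have "p > 0" using assms by auto
  then show ?case using Suc by (auto simp: mod_Suc)
qed

lemma funpow_cycle_mod:
  assumes "a \<in> labels n p"
  shows "(cycle_Y p ^^ (k mod p)) a = (cycle_Y p ^^ k) a"
  using assms by (auto simp: labels_def funpow_cycle_X funpow_cycle_Y mod_add_right_eq simp del: add_diff_assoc2)

lemma funpow_cycle_in_labels:
  assumes "a \<in> labels n p"
  shows "(cycle_Y p ^^ k) a \<in> labels n p"
proof -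
  have "Suc (m mod p) \<le> p" if "p > 0" for m
    using that by (simp add: Suc_leI)
  then show ?thesis
    using assms by (auto simp: labels_def funpow_cycle_X funpow_cycle_Y)
qed

lemma cyclic_action_add:
  assumes "p > 0" "0 \<le> k" "0 \<le> l" "A \<subseteq> labels n p"
  shows "cyclic_action n p ((k + l) mod int p) A = cyclic_action n p k (cyclic_action n p l A)"
proof -
  have sub: "(cycle_Y p ^^ m) ` A \<subseteq> labels n p" for m
    using assms(4) funpow_cycle_in_labels by blast
  have "nat ((k + l) mod int p) = (nat k + nat l) mod p"
    using assms by (simp add: nat_mod_distrib nat_add_distrib)
  moreover have "(cycle_Y p ^^ ((nat k + nat l) mod p)) ` A = (cycle_Y p ^^ (nat k + nat l)) ` A"
    using assms(4) by (intro image_cong refl funpow_cycle_mod) auto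
  ultimately show ?thesis
    using assms(4) sub by (simp add: cyclic_action_def funpow_add image_comp)
qed

lemma cyclic_action_0: "A \<subseteq> labels n p \<Longrightarrow> cyclic_action n p 0 A = A"
  by (simp add: cyclic_action_def)

lemma cyclic_action_closed: "A \<subseteq> labels n p \<Longrightarrow> cyclic_action n p k A \<subseteq> labels n p"
  using funpow_cycle_in_labels by (auto simp: cyclic_action_def)

lemma cyclic_action_inverse:
  assumes "0 \<le> k" "k < int p" "A \<subseteq> labels n p"
  shows "cyclic_action n p k (cyclic_action n p (int p - k) A) = A"
    and "cyclic_action n p (int p - k) (cyclic_action n p k A) = A"
  using cyclic_action_add[of p k "int p - k" A n] cyclic_action_add[of p "int p - k" k A n] assms
  by (simp_all add: cyclic_action_0)

lemma group_action_cyclic_action: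
  assumes "p > 0"
  shows "group_action (integer_mod_group p) (Pow (labels n p)) (cyclic_action n p)"
proof -
  let ?V = "Pow (labels n p)"
  have carr: "k \<in> carrier (integer_mod_group p) \<longleftrightarrow> 0 \<le> k \<and> k < int p" for k
    using assms by (simp add: carrier_integer_mod_group)
  have Bij: "cyclic_action n p k \<in> Bij ?V" if "0 \<le> k" "k < int p" for k
  proof -
    have "bij_betw (cyclic_action n p k) ?V ?V"
      using that
      by (intro bij_betw_byWitness[where f' = "cyclic_action n p (int p - k)"])
        (auto simp: cyclic_action_inverse dest: subsetD[OF cyclic_action_closed])
    then show ?thesis
      by (simp add: Bij_def cyclic_action_def)
  qed
  have "cyclic_action n p ((k + l) mod int p) =
        compose ?V (cyclic_action n p k) (cyclic_action n p l)" if "0 \<le> k" "0 \<le> l" for k l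
  proof (rule extensionalityI[where A = ?V])
    fix A assume "A \<in> ?V"
    with assms that show "cyclic_action n p ((k + l) mod int p) A =
        compose ?V (cyclic_action n p k) (cyclic_action n p l) A"
      by (simp add: compose_def cyclic_action_add)
  qed (simp_all add: cyclic_action_def compose_def)
  with Bij have "cyclic_action n p \<in> hom (integer_mod_group p) (BijGroup ?V)"
    by (auto simp: hom_def BijGroup_def carr)
  then show ?thesis
    by (simp add: group_action_def group_hom_def group_hom_axioms_def group_BijGroup)
qed

lemma hypergraph_action_cyclic_action:
  assumes "p > 0"
  shows "hypergraph_action (integer_mod_group p) (cyclic_action n p) (cube (labels n p) d)"
proof -
  have "cyclic_action n p k ` h \<in> hyperedges (cube (labels n p) d)"
    if k: "0 \<le> k" "k < int p" and h: "h \<in> hyperedges (cube (labels n p) d)" for k h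
  proof -
    let ?f = "cycle_Y p ^^ nat k" and ?L = "labels n p"
    obtain A T where h: "h = {A \<union> B | B. B \<subseteq> T}" and AT: "T \<subseteq> ?L" "card T = d" "A \<subseteq> ?L - T"
      using h by (auto simp: cube_def)
    have "inj_on (cyclic_action n p k) (Pow ?L)"
      by (rule inj_on_inverseI[where g = "cyclic_action n p (int p - k)"])
        (simp add: cyclic_action_inverse k)
    then have inj: "inj_on ?f ?L"
    proof (intro inj_onI)
      fix a b assume inj: "inj_on (cyclic_action n p k) (Pow ?L)"
        and ab: "a \<in> ?L" "b \<in> ?L" "?f a = ?f b"
      then have "cyclic_action n p k {a} = cyclic_action n p k {b}"
        by (simp add: cyclic_action_def)
      with inj ab have "{a} = {b}"
        by (elim inj_onD) auto
      then show "a = b" by simp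
    qed
    have "?f ` A \<subseteq> ?L - ?f ` T"
    proof
      fix b assume "b \<in> ?f ` A"
      then obtain a where a: "a \<in> A" "b = ?f a" by blast
      have "a \<in> ?L" "a \<notin> T" using a AT by auto
      then have "?f a \<notin> ?f ` T" using inj_on_image_mem_iff[OF inj _ AT(1)] by simp
      moreover have "?f a \<in> ?L" using funpow_cycle_in_labels \<open>a \<in> ?L\<close> .
      ultimately show "b \<in> ?L - ?f ` T" using a by simp
    qed
    moreover have "?f ` T \<subseteq> ?L"
      using AT(1) funpow_cycle_in_labels[of _ n p "nat k"] by (intro image_subsetI) (simp add: subset_iff)
    moreover have "card (?f ` T) = d"
      using card_image[OF inj_on_subset[OF inj AT(1)]] AT(2) by simp
    moreover have "cyclic_action n p k ` h = {?f ` A \<union> B | B. B \<subseteq> ?f ` T}"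
    proof -
      have "cyclic_action n p k (A \<union> B) = ?f ` A \<union> ?f ` B" if "B \<subseteq> T" for B
      proof -
        have "A \<union> B \<subseteq> ?L" using that AT by blast
        then show ?thesis by (simp add: cyclic_action_def image_Un)
      qed
      then have "cyclic_action n p k ` (\<lambda>B. A \<union> B) ` Pow T = (\<lambda>B. ?f ` A \<union> B) ` ((`) ?f ` Pow T)"
        unfolding image_image by (intro image_cong) auto
      moreover have "(`) ?f ` Pow T = Pow (?f ` T)"
        by (rule image_Pow_surj) simp
      moreover have "{C \<union> B | B. B \<subseteq> R} = (\<lambda>B. C \<union> B) ` Pow R" for C R :: "label set"
        by blast
      ultimately show ?thesis
        unfolding h by simp
    qed
    ultimately show ?thesis
      unfolding cube_def hypergraph.simps mem_Collect_eq by blast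
  qed
  then show ?thesis
    using assms group_action_cyclic_action[OF assms, of n]
    by (auto simp: hypergraph_action_def carrier_integer_mod_group cube_def)
qed

end

theory Submission
  imports Defs
begin

text \<open>
  The contraction is a majority vote. Write \<open>S\<close> for the set of labels. Given a vertex \<open>C \<subseteq> S\<close> of
  the cube, let the \<open>p\<close> rotations of \<open>C\<close> vote, for every label separately, on whether that label
  belongs to a new set \<open>M C\<close>. As \<open>p\<close> is odd there are no ties, and \<open>M C\<close> is invariant under
  rotation (\<open>cyclic_action_majority\<close>).

  A face of codimension two prescribes the membership of just two labels \<open>a\<close> and \<open>b\<close>. Fewer than
  half of the rotations of \<open>C\<close> disagree with \<open>M C\<close> at \<open>a\<close>, and fewer than half disagree at \<open>b\<close>, so
  some rotation agrees with \<open>M C\<close> at both. Hence if \<open>M C\<close> lies in the face, then so does a rotation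
  of \<open>C\<close> (\<open>rotation_in_face\<close>). Read contrapositively in the quotient, a simplex of \<open>\<Theta>\<close> stays a
  simplex when the orbits of \<open>M C\<close> are added to it, for all orbits of \<open>C\<close> that it contains: the
  vertex map \<open>C \<mapsto> M C\<close> is contiguous to the identity, so the map that it induces on the realization
  is homotopic to the identity.

  All values of this vertex map lie in one simplex. Indeed a rotation invariant set contains both
  of \<open>Y 1\<close>, \<open>Y 2\<close> or neither of them, so no invariant set lies in the face that prescribes \<open>Y 1\<close> in
  and \<open>Y 2\<close> out. A simplex being convex, the induced map is homotopic to a constant.

  Both homotopies are straight lines in barycentric coordinates; they are continuous since the
  complex is finite, which makes the weak topology the product topology.
\<close>

section \<open>Contiguous vertex maps on a finite complex\<close>

lemma closed_closed_simplex: "closed (closed_simplex \<sigma>)"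
proof -
  have "closed {t :: 'a \<Rightarrow> real. 0 \<le> t v}" for v
    by (intro closed_Collect_le continuous_intros continuous_on_product_coordinates)
  moreover have "closed {t :: 'a \<Rightarrow> real. v \<notin> \<sigma> \<longrightarrow> t v = 0}" for v
    by (intro closed_Collect_imp closed_Collect_eq continuous_intros
        continuous_on_product_coordinates open_Collect_const)
  moreover have "closed {t :: 'a \<Rightarrow> real. (\<Sum>v\<in>\<sigma>. t v) = 1}"
    by (intro closed_Collect_eq continuous_intros continuous_on_product_coordinates)
  ultimately show ?thesis
    unfolding closed_simplex_def by (intro closed_Collect_conj closed_Collect_all)
qed

lemma closed_simplex_mono:
  assumes "\<sigma> \<subseteq> \<tau>" "finite \<tau>"
  shows "closed_simplex \<sigma> \<subseteq> closed_simplex \<tau>"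
proof
  fix t assume t: "t \<in> closed_simplex \<sigma>"
  then have "(\<Sum>v\<in>\<tau>. t v) = (\<Sum>v\<in>\<sigma>. t v)"
    using assms by (intro sum.mono_neutral_right) (auto simp: closed_simplex_def)
  with t assms show "t \<in> closed_simplex \<tau>"
    by (auto simp: closed_simplex_def)
qed

lemma closed_simplex_convex_combination:
  assumes "t \<in> closed_simplex \<sigma>" "u \<in> closed_simplex \<sigma>" "s \<in> {0..1}"
  shows "(\<lambda>v. (1 - s) * t v + s * u v) \<in> closed_simplex \<sigma>"
proof -
  have "(\<Sum>v\<in>\<sigma>. (1 - s) * t v + s * u v) = (1 - s) * (\<Sum>v\<in>\<sigma>. t v) + s * (\<Sum>v\<in>\<sigma>. u v)"
    by (simp add: sum.distrib sum_distrib_left)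
  then show ?thesis
    using assms by (simp add: closed_simplex_def)
qed

text \<open>
  Closed simplices are closed in the product topology, and a set that is closed in each of
  finitely many closed pieces is closed in their union. So a finite complex carries a topology in
  which continuity can be checked coordinate by coordinate.
\<close>

lemma realization_finite:
  assumes "finite K"
  shows "realization K = top_of_set (\<Union>\<sigma>\<in>K. closed_simplex \<sigma>)"
proof (rule topology_eq[THEN iffD2], intro allI iffI)
  let ?R = "\<Union>\<sigma>\<in>K. closed_simplex \<sigma>"
  fix U
  assume U: "openin (realization K) U"
  have "closedin (top_of_set ?R) (closed_simplex \<sigma> - U)" if "\<sigma> \<in> K" for \<sigma>
  proof -
    have "openin (top_of_set (closed_simplex \<sigma>)) (U \<inter> closed_simplex \<sigma>)"
      using U that by (simp add: openin_realization)
    then have "closedin (top_of_set (closed_simplex \<sigma>)) (closed_simplex \<sigma> - U \<inter> closed_simplex \<sigma>)"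
      by (metis closedin_diff closedin_topspace topspace_euclidean_subtopology)
    then have "closed (closed_simplex \<sigma> - U)"
      using closed_closed_simplex closedin_closed_trans by (metis Diff_Int2 Diff_Int_distrib inf.idem)
    then show ?thesis
      using that by (intro closed_subset) auto
  qed
  then have "closedin (top_of_set ?R) (\<Union>\<sigma>\<in>K. closed_simplex \<sigma> - U)"
    using assms by (intro closedin_Union) auto
  also have "(\<Union>\<sigma>\<in>K. closed_simplex \<sigma> - U) = ?R - U"
    by blast
  finally show "openin (top_of_set ?R) U"
    using U by (simp add: openin_closedin_eq[of "top_of_set ?R"] openin_realization)
next
  let ?R = "\<Union>\<sigma>\<in>K. closed_simplex \<sigma>"
  fix U
  assume "openin (top_of_set ?R) U"
  then show "openin (realization K) U"
    unfolding openin_realization openin_open by blast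
qed

text \<open>
  A closed simplex is convex, so the segments between corresponding images stay in the complex.
  The common simplex may vary with the point in any manner: continuity of the homotopy comes from
  the coordinates alone.
\<close>

lemma homotopic_with_common_simplex:
  assumes fin: "finite K"
    and f: "continuous_map (top_of_set A) (realization K) f"
    and g: "continuous_map (top_of_set A) (realization K) g"
    and common: "\<And>t. t \<in> A \<Longrightarrow> \<exists>\<sigma>\<in>K. f t \<in> closed_simplex \<sigma> \<and> g t \<in> closed_simplex \<sigma>"
  shows "homotopic_with (\<lambda>_. True) (top_of_set A) (realization K) f g"
proof -
  let ?h = "\<lambda>(s, t) v. (1 - s) * f t v + s * g t v"
  have "continuous_on A f" "continuous_on A g"
    using f g by (auto simp: realization_finite[OF fin])
  then have coord: "continuous_on A (\<lambda>t. f t v)" "continuous_on A (\<lambda>t. g t v)" for v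
    by (auto intro: continuous_on_product_then_coordinatewise)
  have "continuous_on ({0..1} \<times> A) (\<lambda>z. ?h z v)" for v
    unfolding case_prod_unfold
    by (intro continuous_intros continuous_on_compose2[OF coord(1)]
        continuous_on_compose2[OF coord(2)]) auto
  then have "continuous_on ({0..1} \<times> A) ?h"
    by (intro continuous_on_coordinatewise_then_product)
  moreover have "?h ` ({0..1} \<times> A) \<subseteq> (\<Union>\<sigma>\<in>K. closed_simplex \<sigma>)"
  proof clarify
    fix s :: real and t assume "s \<in> {0..1}" "t \<in> A"
    then show "(\<lambda>v. (1 - s) * f t v + s * g t v) \<in> (\<Union>\<sigma>\<in>K. closed_simplex \<sigma>)"
      using common[of t] closed_simplex_convex_combination by blast
  qed
  ultimately have "continuous_map (prod_topology (top_of_set {0..1}) (top_of_set A))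
      (realization K) ?h"
    by (simp add: realization_finite[OF fin] image_subset_iff_funcset)
  then show ?thesis
    unfolding homotopic_with_def by (intro exI[of _ ?h]) auto
qed

text \<open>
  The map that the vertex map \<open>r\<close> induces on barycentric coordinates: the weight at \<open>v\<close> becomes
  the total weight of the fibre of \<open>r\<close> over \<open>v\<close>.
\<close>

definition affine_extension :: "'a set \<Rightarrow> ('a \<Rightarrow> 'a) \<Rightarrow> ('a \<Rightarrow> real) \<Rightarrow> 'a \<Rightarrow> real" where
  "affine_extension V r t = (\<lambda>v. \<Sum>w\<in>V. if r w = v then t w else 0)"

lemma affine_extension_closed_simplex:
  assumes "finite V" "\<sigma> \<subseteq> V" "finite \<tau>" "r ` \<sigma> \<subseteq> \<tau>" and t: "t \<in> closed_simplex \<sigma>"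
  shows "affine_extension V r t \<in> closed_simplex \<tau>"
proof -
  have nonneg: "0 \<le> t v" and supp: "v \<notin> \<sigma> \<Longrightarrow> t v = 0" and total: "(\<Sum>v\<in>\<sigma>. t v) = 1" for v
    using t by (auto simp: closed_simplex_def)
  have "affine_extension V r t v = 0" if "v \<notin> \<tau>" for v
    unfolding affine_extension_def using that assms(4) supp by (intro sum.neutral) auto
  moreover have "(\<Sum>v\<in>\<tau>. affine_extension V r t v) = 1"
  proof -
    have "(\<Sum>v\<in>\<tau>. affine_extension V r t v) = (\<Sum>w\<in>V. \<Sum>v\<in>\<tau>. if r w = v then t w else 0)"
      unfolding affine_extension_def by (rule sum.swap)
    also have "\<dots> = (\<Sum>w\<in>V. t w)"
      using assms(3,4) supp by (intro sum.cong refl) auto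
    also have "\<dots> = 1"
      unfolding total[symmetric] using assms(1,2) supp by (intro sum.mono_neutral_right) auto
    finally show ?thesis .
  qed
  ultimately show ?thesis
    using nonneg by (simp add: closed_simplex_def affine_extension_def sum_nonneg)
qed

text \<open>
  If \<open>r\<close> is contiguous to the identity, then \<open>t\<close> and its image under the extension of \<open>r\<close> lie in
  the closed simplex of \<open>\<sigma> \<union> r ` \<sigma>\<close>; if moreover \<open>r\<close> maps everything into \<open>\<tau>\<close>, then that image
  and a fixed vertex of \<open>\<tau>\<close> lie in the closed simplex of \<open>\<tau>\<close>. Two straight-line homotopies
  contract the complex.
\<close>

lemma contractible_realization_contiguous:
  fixes K :: "'a set set"
  assumes fin: "finite (\<Union>K)"
    and contiguous: "\<And>\<sigma>. \<sigma> \<in> K \<Longrightarrow> \<sigma> \<union> r ` \<sigma> \<in> K"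
    and \<tau>: "\<tau> \<in> K" "\<tau> \<noteq> {}" "r ` \<Union>K \<subseteq> \<tau>"
  shows "topspace (realization K) \<noteq> {} \<and> contractible_space (realization K)"
proof -
  let ?R = "\<Union>\<sigma>\<in>K. closed_simplex \<sigma>" and ?r = "affine_extension (\<Union>K) r"
  have finK: "finite K"
    using fin by (rule finite_UnionD)
  have fin_simplex: "finite \<sigma>" if "\<sigma> \<in> K" for \<sigma>
    using that fin by (meson Union_upper finite_subset)
  obtain v where v: "v \<in> \<tau>"
    using \<tau>(2) by blast
  define c :: "'a \<Rightarrow> real" where "c = (\<lambda>w. if w = v then 1 else 0)"
  have c: "c \<in> closed_simplex \<tau>"
    using v fin_simplex[OF \<tau>(1)] by (auto simp: closed_simplex_def c_def)
  have "\<exists>\<sigma>'\<in>K. t \<in> closed_simplex \<sigma>' \<and> ?r t \<in> closed_simplex \<sigma>'" and r_\<tau>: "?r t \<in> closed_simplex \<tau>"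
    if "t \<in> ?R" for t
  proof -
    from that obtain \<sigma> where \<sigma>: "\<sigma> \<in> K" "t \<in> closed_simplex \<sigma>"
      by blast
    have "?r t \<in> closed_simplex (\<sigma> \<union> r ` \<sigma>)"
      using \<sigma> fin fin_simplex[OF \<sigma>(1)] by (intro affine_extension_closed_simplex) auto
    moreover have "t \<in> closed_simplex (\<sigma> \<union> r ` \<sigma>)"
      using \<sigma> closed_simplex_mono[of \<sigma> "\<sigma> \<union> r ` \<sigma>"] fin_simplex[OF \<sigma>(1)] by auto
    ultimately show "\<exists>\<sigma>'\<in>K. t \<in> closed_simplex \<sigma>' \<and> ?r t \<in> closed_simplex \<sigma>'"
      using contiguous[OF \<sigma>(1)] by blast
    show "?r t \<in> closed_simplex \<tau>"
      using \<sigma> \<tau> fin fin_simplex[OF \<tau>(1)] by (intro affine_extension_closed_simplex[where \<sigma> = \<sigma>]) auto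
  qed
  note contig = this(1)
  have "continuous_on ?R (\<lambda>t. if r w = u then t w else 0)" for w u
    by (cases "r w = u") (auto intro: continuous_on_subset[OF continuous_on_product_coordinates])
  then have "continuous_on ?R ?r"
    unfolding affine_extension_def
    by (intro continuous_on_coordinatewise_then_product continuous_on_sum)
  then have r_cont: "continuous_map (top_of_set ?R) (realization K) ?r"
    using r_\<tau> \<tau>(1) unfolding realization_finite[OF finK] by (auto simp: Pi_iff)
  have id_cont: "continuous_map (top_of_set ?R) (realization K) id"
    unfolding realization_finite[OF finK] by simp
  have const_cont: "continuous_map (top_of_set ?R) (realization K) (\<lambda>_. c)"
    using c \<tau>(1) unfolding realization_finite[OF finK] by auto
  have "homotopic_with (\<lambda>_. True) (top_of_set ?R) (realization K) id ?r"
    using contig by (intro homotopic_with_common_simplex[OF finK id_cont r_cont]) auto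
  moreover have "homotopic_with (\<lambda>_. True) (top_of_set ?R) (realization K) ?r (\<lambda>_. c)"
    using r_\<tau> c \<tau>(1) by (intro homotopic_with_common_simplex[OF finK r_cont const_cont]) blast
  ultimately have "homotopic_with (\<lambda>_. True) (top_of_set ?R) (realization K) id (\<lambda>_. c)"
    by (rule homotopic_with_trans)
  then have "contractible_space (realization K)"
    unfolding contractible_space_def by (auto simp: realization_finite[OF finK])
  moreover have "topspace (realization K) \<noteq> {}"
    using c \<tau>(1) unfolding topspace_realization by blast
  ultimately show ?thesis
    by blast
qed


section \<open>Majority over the rotations of a set of labels\<close>

definition majority :: "nat \<Rightarrow> nat \<Rightarrow> label set \<Rightarrow> label set" where
  "majority n p C =
     {a \<in> labels n p. p < 2 * card {k. k < p \<and> a \<in> (cycle_Y p ^^ k) ` C}}"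

lemma majority_subset: "majority n p C \<subseteq> labels n p"
  by (auto simp: majority_def)

lemma inj_on_cycle_Y: "inj_on (cycle_Y p) (labels n p)"
proof (cases p)
  case 0
  then show ?thesis
    by (auto intro!: inj_onI simp: labels_def)
next
  case (Suc q)
  \<comment> \<open>the remaining \<open>p - 1\<close> steps of a full turn undo the first one\<close>
  have "(cycle_Y p ^^ q) (cycle_Y p a) = a" if "a \<in> labels n p" for a
  proof -
    have "(cycle_Y p ^^ q) (cycle_Y p a) = (cycle_Y p ^^ p) a"
      by (simp only: Suc funpow.simps comp_apply funpow_swap1)
    also have "\<dots> = (cycle_Y p ^^ (p mod p)) a"
      by (rule funpow_cycle_mod[OF that, symmetric])
    finally show ?thesis
      by simp
  qed
  then show ?thesis
    by (rule inj_on_inverseI)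
qed

lemma cycle_Y_in_labels: "a \<in> labels n p \<Longrightarrow> cycle_Y p a \<in> labels n p"
  using funpow_cycle_in_labels[of a n p 1] by simp

text \<open>
  When \<open>k\<close> votes for \<open>a\<close>, its successor modulo \<open>p\<close> votes for the rotated label, so a rotated label
  gets at least as many votes.
\<close>

lemma cycle_Y_image_majority:
  assumes "C \<subseteq> labels n p"
  shows "cycle_Y p ` majority n p C = majority n p C"
proof -
  let ?votes = "\<lambda>a. {k. k < p \<and> a \<in> (cycle_Y p ^^ k) ` C}"
  have "card (?votes a) \<le> card (?votes (cycle_Y p a))" for a
  proof (rule card_inj_on_le[where f = "\<lambda>k. Suc k mod p"])
    show "inj_on (\<lambda>k. Suc k mod p) (?votes a)"
      by (auto simp: inj_on_def mod_Suc split: if_splits)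
    show "(\<lambda>k. Suc k mod p) ` ?votes a \<subseteq> ?votes (cycle_Y p a)"
    proof clarify
      fix k c assume k: "k < p" and c: "c \<in> C"
      have "cycle_Y p ((cycle_Y p ^^ k) c) = (cycle_Y p ^^ (Suc k mod p)) c"
        using assms c funpow_cycle_mod[of c n p "Suc k"] by auto
      with k c show "Suc k mod p < p \<and>
          cycle_Y p ((cycle_Y p ^^ k) c) \<in> (cycle_Y p ^^ (Suc k mod p)) ` C"
        by simp
    qed
  qed simp
  then have "p < 2 * card (?votes (cycle_Y p a))" if "p < 2 * card (?votes a)" for a
    using that by (meson less_le_trans mult_le_mono2)
  then have "cycle_Y p ` majority n p C \<subseteq> majority n p C"
    using cycle_Y_in_labels by (simp add: majority_def image_subset_iff)
  \<comment> \<open>an injective map of a finite set into itself is onto\<close>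
  moreover have "finite (majority n p C)"
    using majority_subset finite_labels by (rule finite_subset)
  moreover have "inj_on (cycle_Y p) (majority n p C)"
    using inj_on_cycle_Y majority_subset by (rule inj_on_subset)
  ultimately show ?thesis
    by (simp add: endo_inj_surj)
qed

lemma cyclic_action_majority:
  assumes "C \<subseteq> labels n p"
  shows "cyclic_action n p k (majority n p C) = majority n p C"
proof -
  have "(cycle_Y p ^^ m) ` majority n p C = majority n p C" for m
  proof (induction m)
    case (Suc m)
    have "(cycle_Y p ^^ Suc m) ` majority n p C = cycle_Y p ` (cycle_Y p ^^ m) ` majority n p C"
      by (simp add: image_comp)
    also have "\<dots> = majority n p C"
      using Suc cycle_Y_image_majority[OF assms] by simp
    finally show ?case .
  qed simp
  then show ?thesis
    using majority_subset by (simp add: cyclic_action_def)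
qed

text \<open>
  The set counted here consists of the votes against the outcome. A label is left out when its
  votes do not exceed half; only for odd \<open>p\<close> is that a strict minority.
\<close>

lemma card_minority:
  assumes "odd p" "a \<in> labels n p"
  shows "2 * card {k. k < p \<and> (a \<in> (cycle_Y p ^^ k) ` C \<longleftrightarrow> a \<notin> majority n p C)} < p"
proof (cases "a \<in> majority n p C")
  case True
  let ?for = "{k. k < p \<and> a \<in> (cycle_Y p ^^ k) ` C}"
    and ?against = "{k. k < p \<and> a \<notin> (cycle_Y p ^^ k) ` C}"
  have "card ?for + card ?against = card (?for \<union> ?against)"
    by (rule card_Un_disjoint[symmetric]) auto
  also have "?for \<union> ?against = {..<p}"
    by auto
  finally show ?thesis
    using True by (simp add: majority_def)
next
  case False
  then have "2 * card {k. k < p \<and> a \<in> (cycle_Y p ^^ k) ` C} \<le> p"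
    using assms(2) by (simp add: majority_def)
  moreover have "2 * m \<noteq> p" for m
    using assms(1) by auto
  ultimately show ?thesis
    using False by (simp add: le_less)
qed

text \<open>Two minorities cannot cover all rotations.\<close>

lemma rotation_agreeing_with_majority:
  assumes "odd p" "a \<in> labels n p" "b \<in> labels n p"
  obtains k where "k < p" "\<And>c. c \<in> {a, b} \<Longrightarrow> c \<in> (cycle_Y p ^^ k) ` C \<longleftrightarrow> c \<in> majority n p C"
proof -
  let ?bad = "\<lambda>c. {k. k < p \<and> (c \<in> (cycle_Y p ^^ k) ` C \<longleftrightarrow> c \<notin> majority n p C)}"
  have "card (?bad a \<union> ?bad b) < card {..<p}"
    using card_Un_le[of "?bad a" "?bad b"] card_minority[OF assms(1,2), of C]
      card_minority[OF assms(1,3), of C] by simp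
  then have "\<not> {..<p} \<subseteq> ?bad a \<union> ?bad b"
    by (metis (no_types, lifting) card_mono finite_Un finite_nat_set_iff_bounded mem_Collect_eq not_le)
  then obtain k where "k < p" "k \<notin> ?bad a" "k \<notin> ?bad b"
    by blast
  then show ?thesis
    by (intro that[of k]) auto
qed


section \<open>Faces of codimension two\<close>

text \<open>
  The labels \<open>a\<close> and \<open>b\<close> are the two directions in which the face does not extend, so membership
  in the face is decided by them.
\<close>

lemma cube_face_codim2:
  assumes h: "h \<in> hyperedges (cube S k)" and card: "card S = k + 2"
  obtains a b where "a \<in> S" "b \<in> S" "h \<subseteq> Pow S"
    "\<And>C D. C \<in> h \<Longrightarrow> D \<subseteq> S \<Longrightarrow> D \<inter> {a, b} = C \<inter> {a, b} \<Longrightarrow> D \<in> h"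
proof -
  obtain A T where h: "h = {A \<union> B | B. B \<subseteq> T}" and T: "T \<subseteq> S" "card T = k" and A: "A \<subseteq> S - T"
    using h by (auto simp: cube_def)
  have "finite S"
    using card by (metis add_2_eq_Suc' card.infinite nat.distinct(1))
  then have "card (S - T) = 2"
    using T card by (simp add: card_Diff_subset finite_subset)
  then obtain a b where ab: "S - T = {a, b}"
    by (auto simp: card_2_iff)
  show thesis
  proof
    show "a \<in> S" "b \<in> S"
      using ab by auto
    show "h \<subseteq> Pow S"
      using A T unfolding h by blast
    fix C D assume "C \<in> h" and D: "D \<subseteq> S" "D \<inter> {a, b} = C \<inter> {a, b}"
    then have "D \<inter> (S - T) = A"
      using A T unfolding h ab[symmetric] by blast
    then have "D = A \<union> (D \<inter> T)"
      using D(1) by blast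
    then show "D \<in> h"
      unfolding h by blast
  qed
qed

text \<open>
  A rotation that agrees with the majority at the two deciding labels lies in every face that
  they decide and that contains the majority set.
\<close>

lemma rotation_in_face:
  assumes "odd p" "p \<le> n" "2 \<le> n"
    and h: "h \<in> hyperedges (cube (labels n p) (n - 2))"
    and C: "C \<subseteq> labels n p" and maj: "majority n p C \<in> h"
  obtains k where "k < p" "(cycle_Y p ^^ k) ` C \<in> h"
proof -
  have "card (labels n p) = n - 2 + 2"
    using assms by (simp add: card_labels)
  then obtain a b where ab: "a \<in> labels n p" "b \<in> labels n p"
    and face: "\<And>C D. C \<in> h \<Longrightarrow> D \<subseteq> labels n p \<Longrightarrow> D \<inter> {a, b} = C \<inter> {a, b} \<Longrightarrow> D \<in> h"
    using cube_face_codim2[OF h] by metis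
  obtain k where k: "k < p"
    "\<And>c. c \<in> {a, b} \<Longrightarrow> c \<in> (cycle_Y p ^^ k) ` C \<longleftrightarrow> c \<in> majority n p C"
    using rotation_agreeing_with_majority[OF assms(1) ab, of C] by blast
  have "(cycle_Y p ^^ k) ` C \<subseteq> labels n p"
    using C funpow_cycle_in_labels by blast
  moreover have "(cycle_Y p ^^ k) ` C \<inter> {a, b} = majority n p C \<inter> {a, b}"
    using k(2) by blast
  ultimately show thesis
    using that[OF k(1)] face[OF maj] by blast
qed

text \<open>
  The face that requires \<open>Y 1\<close> and forbids \<open>Y 2\<close>; its existence is where the action has to be
  nontrivial.
\<close>

lemma face_without_invariant_sets:
  assumes "2 \<le> p" "p \<le> n"
  obtains h where "h \<in> hyperedges (cube (labels n p) (n - 2))"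
    "\<And>C. C \<in> h \<Longrightarrow> cycle_Y p ` C \<noteq> C"
proof
  let ?T = "labels n p - {Y 1, Y 2}"
  let ?h = "{{Y 1} \<union> B | B. B \<subseteq> ?T}"
  have Y: "Y 1 \<in> labels n p" "Y 2 \<in> labels n p"
    using assms by (auto simp: labels_def)
  then have "card ?T = n - 2"
    using assms by (simp add: card_Diff_subset card_labels finite_labels)
  then show "?h \<in> hyperedges (cube (labels n p) (n - 2))"
    using Y unfolding cube_def hypergraph.simps by (intro CollectI exI[of _ "{Y 1}"] exI[of _ ?T]) auto
  fix C assume "C \<in> ?h"
  then have "Y 1 \<in> C" "Y 2 \<notin> C"
    by auto
  moreover have "cycle_Y p (Y 1) = Y 2"
    using assms by (simp add: numeral_2_eq_2)
  ultimately show "cycle_Y p ` C \<noteq> C"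
    by (metis imageI)
qed


section \<open>Contractibility of the quotient complex\<close>

theorem theorem10:
  fixes n p :: nat
    and \<H> :: "label set set hypergraph"
  assumes "prime p"
    and "odd p"
    and "n \<ge> p"
    and "\<H> = quotient_hypergraph (integer_mod_group p) (cyclic_action n p)
                (cube (labels n p) (n - 2))"
  shows "topspace (realization (Theta \<H>)) \<noteq> {} \<and> contractible_space (realization (Theta \<H>))"
proof -
  let ?S = "labels n p"
  let ?Q = "cube ?S (n - 2)"
  let ?orb = "orbit (integer_mod_group p) (cyclic_action n p)"
  have p: "2 \<le> p"
    using assms(1) by (rule prime_ge_2_nat)
  interpret group_action "integer_mod_group p" "Pow ?S" "cyclic_action n p"
    using p by (intro group_action_cyclic_action) simp
  have verts: "verts \<H> = ?orb ` Pow ?S"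
    and edges: "hyperedges \<H> = (\<lambda>h. ?orb ` h) ` hyperedges ?Q"
    by (auto simp: assms(4) quotient_hypergraph_def orbits_def cube_def)
  have face_sub: "h \<subseteq> Pow ?S" if "h \<in> hyperedges ?Q" for h
    using that wf_cube[of ?S "n - 2"] by (auto simp: wf_hypergraph_def cube_def)
  have orb_sub: "D \<subseteq> ?S" if "C \<subseteq> ?S" "D \<in> ?orb C" for C D
  proof -
    from that(2) obtain g where "D = cyclic_action n p g C"
      unfolding orbit_def by blast
    then show ?thesis
      using cyclic_action_closed[OF that(1)] by simp
  qed
  have orb_eq: "?orb D = ?orb C" if C: "C \<subseteq> ?S" and D: "D \<in> ?orb C" for C D
  proof -
    have trans: "?orb B \<subseteq> ?orb A" if A: "A \<subseteq> ?S" and B: "B \<in> ?orb A" for A B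
    proof
      fix E assume E: "E \<in> ?orb B"
      have "B \<subseteq> ?S"
        using A B by (rule orb_sub)
      moreover from this have "E \<subseteq> ?S"
        using E by (rule orb_sub)
      ultimately show "E \<in> ?orb A"
        using orbit_trans[of A B E] A B E by simp
    qed
    have D_sub: "D \<subseteq> ?S"
      using C D by (rule orb_sub)
    then have "C \<in> ?orb D"
      using orbit_sym[of C D] C D by simp
    then show ?thesis
      using trans[OF C D] trans[OF D_sub] by (simp add: subset_antisym)
  qed
  have rot_orb: "(cycle_Y p ^^ k) ` C \<in> ?orb C" if "k < p" "C \<subseteq> ?S" for k C
    using that p unfolding orbit_def
    by (intro CollectI exI[of _ "int k"]) (auto simp: cyclic_action_def carrier_integer_mod_group)
  have maj_orb: "?orb (majority n p C) = {majority n p C}" if "C \<subseteq> ?S" for C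
    using cyclic_action_majority[OF that] group_hom group_hom.axioms(1)
    by (auto simp: orbit_def carrier_integer_mod_group intro: exI[of _ 0])

  \<comment> \<open>the argument for \<open>r_avoids\<close> works for whichever representative is chosen\<close>
  define r where "r v = ?orb (majority n p (SOME C. C \<in> v))" for v
  have r: "\<exists>C\<subseteq>?S. v = ?orb C \<and> r v = ?orb (majority n p C)" if v: "v \<in> verts \<H>" for v
  proof -
    obtain C where C: "C \<subseteq> ?S" "v = ?orb C"
      using v verts by auto
    then have "C \<in> v"
      using orbit_refl by simp
    then have some: "(SOME C. C \<in> v) \<in> v"
      by (rule someI)
    moreover have "(SOME C. C \<in> v) \<subseteq> ?S"
      using orb_sub some C by blast
    ultimately show ?thesis
      using orb_eq[OF C(1)] C(2) by (auto simp: r_def)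
  qed
  have r_verts: "r v \<in> verts \<H>" if "v \<in> verts \<H>" for v
    using r[OF that] verts majority_subset by auto
  have r_avoids: "r v \<notin> ?orb ` h" if v: "v \<in> verts \<H>" "v \<notin> ?orb ` h" and h: "h \<in> hyperedges ?Q"
    for v h
  proof
    obtain C where C: "C \<subseteq> ?S" "v = ?orb C" "r v = ?orb (majority n p C)"
      using r[OF v(1)] by blast
    assume "r v \<in> ?orb ` h"
    then obtain D where D: "D \<in> h" "?orb D = {majority n p C}"
      using C maj_orb by auto
    have "D \<in> ?orb D"
      using D(1) face_sub[OF h] by (intro orbit_refl) blast
    then have "majority n p C \<in> h"
      using D by simp
    then obtain k where k: "k < p" "(cycle_Y p ^^ k) ` C \<in> h"
      using rotation_in_face[OF assms(2,3) order_trans[OF p assms(3)] h C(1)] by blast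
    then have "v = ?orb ((cycle_Y p ^^ k) ` C)"
      using orb_eq[OF C(1) rot_orb] C by simp
    with k v(2) show False
      by blast
  qed

  obtain h where h: "h \<in> hyperedges ?Q" "\<And>C. C \<in> h \<Longrightarrow> cycle_Y p ` C \<noteq> C"
    using face_without_invariant_sets[OF p assms(3)] by blast
  have fin: "finite (verts \<H>)"
    unfolding verts using finite_labels by simp
  have Theta_verts: "\<Union>(Theta \<H>) \<subseteq> verts \<H>"
    by (auto simp: Theta_def)
  have r_h: "r v \<notin> ?orb ` h" if v: "v \<in> verts \<H>" for v
  proof
    obtain C where C: "C \<subseteq> ?S" "r v = {majority n p C}"
      using r[OF v] maj_orb by auto
    assume "r v \<in> ?orb ` h"
    then obtain D where D: "D \<in> h" "?orb D = {majority n p C}"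
      using C(2) by auto
    have "D \<in> ?orb D"
      using D(1) face_sub[OF h(1)] by (intro orbit_refl) blast
    then have "majority n p C \<in> h"
      using D by simp
    then show False
      using h(2) cycle_Y_image_majority[OF C(1)] by blast
  qed
  show ?thesis
  proof (rule contractible_realization_contiguous[where r = r and \<tau> = "r ` verts \<H>"])
    show "finite (\<Union>(Theta \<H>))"
      using fin Theta_verts by (rule rev_finite_subset)
    show "\<sigma> \<union> r ` \<sigma> \<in> Theta \<H>" if "\<sigma> \<in> Theta \<H>" for \<sigma>
    proof -
      from that obtain h where \<sigma>: "finite \<sigma>" "\<sigma> \<noteq> {}" "\<sigma> \<subseteq> verts \<H> - ?orb ` h"
        and h: "h \<in> hyperedges ?Q"
        by (auto simp: Theta_def edges)
      have "r v \<in> verts \<H> - ?orb ` h" if "v \<in> \<sigma>" for v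
        using r_verts[of v] r_avoids[of v h] that \<sigma>(3) h by auto
      then have "\<sigma> \<union> r ` \<sigma> \<subseteq> verts \<H> - ?orb ` h"
        using \<sigma>(3) by (intro Un_least image_subsetI)
      with \<sigma>(1,2) h show ?thesis
        unfolding Theta_def edges by (intro CollectI conjI bexI[of _ "?orb ` h"] imageI) simp_all
    qed
    show "r ` verts \<H> \<in> Theta \<H>"
    proof -
      have "r ` verts \<H> \<subseteq> verts \<H> - ?orb ` h"
        using r_h r_verts by (intro image_subsetI DiffI)
      moreover have "verts \<H> \<noteq> {}"
        unfolding verts by auto
      ultimately show ?thesis
        using fin h(1) unfolding Theta_def edges
        by (intro CollectI conjI bexI[of _ "?orb ` h"] imageI) simp_all
    qed
    show "r ` verts \<H> \<noteq> {}"
      unfolding verts by auto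
    show "r ` \<Union>(Theta \<H>) \<subseteq> r ` verts \<H>"
      using Theta_verts by blast
  qed
qed

end
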